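(* Let $r \geq 2$ be an integer and let $G$ be a (finite, simple) labelled graph with vertex set $V(G) = \{v_1, v_2, \ldots, v_n\}$, where $n \geq r+1$. Suppose that $d(u) + d(v) \geq \frac{(2r-3)n - (2r-5)}{r-1}$ for each pair $u, v$ of non-adjacent vertices of $G$, where $d(\cdot)$ denotes degree in $G$. Then for every arboreal sequence $\sigma = d_1, d_2, \ldots, d_n$ with $1 \leq d_i \leq r$ for $i = 1, 2, \ldots, n$, the graph $G$ has a spanning tree $T$ with degree sequence $\sigma$.
   Context: An arboreal sequence is a sequence of positive integers $d_1, d_2, \ldots, d_n$ such that $\sum_{j=1}^{n} d_j = 2(n-1)$. For a labelled graph $G$ with vertex set $\{v_1,\ldots,v_n\}$ and an arboreal sequence $\sigma = d_1,\ldots,d_n$, a spanning tree $T$ of $G$ has degree sequence $\sigma$ if $d_T(v_i) = d_i$ for $i = 1, 2, \ldots, n$, where $d_T(v_i)$ is the degree of $v_i$ in $T$. *)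

theory Defs
  imports Complex_Main "Graph_Theory.Graph_Theory"
begin

text \<open>
  A finite simple graph is a \<^const>\<open>pair_graph\<close>: a finite vertex set with a symmetric irreflexive
  set of arcs, each edge being present as a pair of opposite arcs. Hence the degree of a vertex is
  its \<^const>\<open>out_degree\<close>.
\<close>

abbreviation degree :: "'a pair_pre_digraph \<Rightarrow> 'a \<Rightarrow> nat" where
  "degree G u \<equiv> out_degree (with_proj G) u"

text \<open>
  The library constants \<^const>\<open>tree\<close> and \<^const>\<open>spanning_tree\<close> cannot be used for symmetric digraphs:
  there every edge, traversed back and forth, is a \<^const>\<open>pre_digraph.cycle\<close> of length 2. The
  cycles of the undirected graph are those of length at least 3.
\<close>

definition undirected_forest :: "'a pair_pre_digraph \<Rightarrow> bool" where
  "undirected_forest T \<longleftrightarrow>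
     pair_graph T \<and> \<not> (\<exists>p. pre_digraph.cycle (with_proj T) p \<and> 3 \<le> length p)"

definition undirected_tree :: "'a pair_pre_digraph \<Rightarrow> bool" where
  "undirected_tree T \<longleftrightarrow> connected (with_proj T) \<and> undirected_forest T"

definition undirected_spanning_tree :: "'a pair_pre_digraph \<Rightarrow> 'a pair_pre_digraph \<Rightarrow> bool" where
  "undirected_spanning_tree T G \<longleftrightarrow> undirected_tree T \<and> spanning (with_proj T) (with_proj G)"

text \<open>
  A sequence of length \<open>n\<close> is a function of which only the values at \<open>1, \<dots>, n\<close> matter.
\<close>

definition arboreal :: "nat \<Rightarrow> (nat \<Rightarrow> nat) \<Rightarrow> bool" where
  "arboreal n d \<longleftrightarrow> (\<forall>i\<in>{1..n}. 0 < d i) \<and> int (\<Sum>j=1..n. d j) = 2 * (int n - 1)"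

definition has_degree_sequence ::
  "'a pair_pre_digraph \<Rightarrow> (nat \<Rightarrow> 'a) \<Rightarrow> nat \<Rightarrow> (nat \<Rightarrow> nat) \<Rightarrow> bool" where
  "has_degree_sequence T v n d \<longleftrightarrow> (\<forall>i\<in>{1..n}. degree T (v i) = d i)"

end

theory Submission
  imports Defs
begin

text \<open>
  Let \<open>H\<close> be the complement of \<open>G\<close>; the hypothesis says that
  \<open>(r - 1) (d\<^sub>H u + d\<^sub>H v) \<le> n - 3\<close> for every edge \<open>uv\<close> of \<open>H\<close>. Among all trees on the vertex set
  with the prescribed degrees take one with the fewest edges in \<open>H\<close>, and suppose it contains an
  edge \<open>uv\<close> of \<open>H\<close>. Root the components of the tree minus \<open>uv\<close> at \<open>u\<close> and \<open>v\<close>. For a vertex \<open>w\<close> on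
  the side of \<open>v\<close> with parent \<open>x \<noteq> v\<close>, replacing \<open>uv, xw\<close> by \<open>ux, vw\<close> gives a tree with the same
  degrees, so by minimality \<open>ux\<close> or \<open>vw\<close> is in \<open>H\<close>; symmetrically on the side of \<open>u\<close>. Hence each
  of the \<open>n - 2\<close> vertices \<open>w\<close> is charged to an \<open>H\<close>-neighbour of \<open>u\<close> or of \<open>v\<close> (vertices with
  parent \<open>v\<close> being charged to \<open>v\<close> as a neighbour of \<open>u\<close>, and conversely), and each neighbour is
  charged at most \<open>r - 1\<close> times: \<open>n - 2 \<le> (r - 1) (d\<^sub>H u + d\<^sub>H v) \<le> n - 3\<close>.
\<close>

section \<open>Trees as symmetric relations with prescribed degrees\<close>

text \<open>With relations in place of library digraphs, exchanging edges is set algebra and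
  reachability is \<open>rtrancl\<close>. Each edge is a pair of opposite arcs, so
  \<open>card E\<close> is twice the number of edges.\<close>

definition connected_rel :: "'a set \<Rightarrow> 'a rel \<Rightarrow> bool" where
  "connected_rel V E \<longleftrightarrow> E \<subseteq> V \<times> V \<and> sym E \<and> irrefl E \<and> (\<forall>x\<in>V. \<forall>y\<in>V. (x, y) \<in> E\<^sup>*)"

text \<open>Acyclicity enters through the degrees: with degree sum \<open>2 * (card V - 1)\<close> a
  realization has the fewest arcs that connectedness allows, which makes it a tree.\<close>

definition realization :: "'a set \<Rightarrow> ('a \<Rightarrow> nat) \<Rightarrow> 'a rel \<Rightarrow> bool" where
  "realization V d E \<longleftrightarrow> connected_rel V E \<and> (\<forall>x\<in>V. card (E `` {x}) = d x)"

section \<open>Parents in a breadth-first search\<close>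

text \<open>Every vertex on a walk of \<open>k\<close> steps from \<open>a\<close> is reached in at
  most \<open>k\<close> steps, which is too few for \<open>w\<close>. For a shortest walk this keeps
  the path to a parent clear of the child.\<close>

lemma relpow_avoiding:
  assumes "(a, x) \<in> R ^^ k" "\<And>j. j \<le> k \<Longrightarrow> (a, w) \<notin> R ^^ j"
  shows "(a, x) \<in> {(y, z) \<in> R. y \<noteq> w \<and> z \<noteq> w}\<^sup>*"
  using assms
proof (induction k arbitrary: x)
  case 0
  then show ?case by simp
next
  case (Suc k)
  then obtain y where y: "(a, y) \<in> R ^^ k" "(y, x) \<in> R"
    by auto
  have "y \<noteq> w" "x \<noteq> w"
    using Suc.prems y(1) le_SucI by blast+
  moreover have "(a, y) \<in> {(y, z) \<in> R. y \<noteq> w \<and> z \<noteq> w}\<^sup>*"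
    using Suc.IH[OF y(1)] Suc.prems(2) by auto
  ultimately show ?case
    using y(2) by (auto intro: rtrancl.rtrancl_into_rtrancl)
qed

text \<open>The witnesses are the breadth-first search tree rooted at \<open>a\<close> and the distance from \<open>a\<close>.\<close>

lemma parent_function:
  obtains p :: "'a \<Rightarrow> 'a" and f :: "'a \<Rightarrow> nat"
  where "\<And>w. (a, w) \<in> R\<^sup>* \<Longrightarrow> w \<noteq> a \<Longrightarrow>
    (p w, w) \<in> R \<and> f (p w) < f w \<and> (a, p w) \<in> {(y, z) \<in> R. y \<noteq> w \<and> z \<noteq> w}\<^sup>*"
proof -
  define f where "f w = (LEAST k. (a, w) \<in> R ^^ k)" for w
  have ex: "\<exists>x. (x, w) \<in> R \<and> f x < f w \<and> (a, x) \<in> {(y, z) \<in> R. y \<noteq> w \<and> z \<noteq> w}\<^sup>*"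
    if "(a, w) \<in> R\<^sup>*" "w \<noteq> a" for w
  proof -
    have fw: "(a, w) \<in> R ^^ f w"
      unfolding f_def using that(1) by (metis LeastI rtrancl_imp_relpow)
    with that(2) obtain k where k: "f w = Suc k"
      by (cases "f w") auto
    with fw obtain x where x: "(a, x) \<in> R ^^ k" "(x, w) \<in> R"
      by auto
    have "f x \<le> k"
      unfolding f_def using x(1) by (rule Least_le)
    moreover have "(a, w) \<notin> R ^^ j" if "j \<le> k" for j
      using not_less_Least[of j "\<lambda>k. (a, w) \<in> R ^^ k"] that k unfolding f_def by simp
    ultimately show ?thesis
      using x k relpow_avoiding[OF x(1)] by (intro exI[of _ x]) auto
  qed
  define p where "p w = (SOME x. (x, w) \<in> R \<and> f x < f w \<and>
    (a, x) \<in> {(y, z) \<in> R. y \<noteq> w \<and> z \<noteq> w}\<^sup>*)" for w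
  show ?thesis
    by (rule that[of p f], unfold p_def, rule someI_ex[OF ex])
qed

section \<open>Arc counts and bridges\<close>

text \<open>Every vertex other than a root \<open>a\<close> contributes the arc from its parent and
  the reverse arc. No arc is counted twice, since two vertices that are each other's parent would
  make \<open>f\<close> decrease in both directions.\<close>

lemma card_connected_rel_ge:
  assumes "finite V" "connected_rel V E"
  shows "2 * (card V - 1) \<le> card E"
proof (cases "V = {}")
  case False
  then obtain a where a: "a \<in> V" by blast
  obtain p :: "'a \<Rightarrow> 'a" and f :: "'a \<Rightarrow> nat" where
    pf: "\<And>w. (a, w) \<in> E\<^sup>* \<Longrightarrow> w \<noteq> a \<Longrightarrow>
      (p w, w) \<in> E \<and> f (p w) < f w \<and> (a, p w) \<in> {(y, z) \<in> E. y \<noteq> w \<and> z \<noteq> w}\<^sup>*"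
    by (rule parent_function[of a E]) blast
  have p: "(p w, w) \<in> E" "f (p w) < f w" if "w \<in> V - {a}" for w
    using pf[of w] that a assms(2) unfolding connected_rel_def by auto
  let ?S = "(\<lambda>w. (p w, w)) ` (V - {a})" and ?T = "(\<lambda>w. (w, p w)) ` (V - {a})"
  have fin: "finite E"
    using assms finite_subset[of E "V \<times> V"] unfolding connected_rel_def by auto
  have "?S \<union> ?T \<subseteq> E"
    using p(1) assms(2) unfolding connected_rel_def by (auto dest: symD)
  moreover have "?S \<inter> ?T = {}"
  proof (rule ccontr)
    assume "\<not> ?thesis"
    then obtain e where "e \<in> ?S" "e \<in> ?T" by blast
    then obtain w z where "w \<in> V - {a}" "z \<in> V - {a}" "p w = z" "p z = w"
      by (elim imageE) simp
    then show False
      using p(2)[of w] p(2)[of z] by (metis less_asym)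
  qed
  moreover have "card ?S = card V - 1" "card ?T = card V - 1"
    using a by (auto simp: card_image inj_on_def)
  ultimately show ?thesis
    using fin assms(1) card_mono[of E "?S \<union> ?T"] card_Un_disjoint[of ?S ?T] by simp
qed simp

lemma card_realization:
  assumes "finite V" "realization V d E"
  shows "card E = (\<Sum>x\<in>V. d x)"
proof -
  have "E = Sigma V (\<lambda>x. E `` {x})"
    using assms(2) unfolding realization_def connected_rel_def by auto
  moreover have "finite (E `` {x})" for x
    using assms finite_subset[of "E `` {x}" V] unfolding realization_def connected_rel_def by auto
  ultimately have "card E = (\<Sum>x\<in>V. card (E `` {x}))"
    using assms(1) card_SigmaI[of V "\<lambda>x. E `` {x}"] by simp
  then show ?thesis
    using assms(2) unfolding realization_def by simp
qed

lemma rtrancl_sym_swap: "sym R \<Longrightarrow> (a, b) \<in> R\<^sup>* \<Longrightarrow> (b, a) \<in> R\<^sup>*"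
  by (meson sym_rtrancl symD)

text \<open>By the degree sum, \<open>E\<close> has exactly \<open>2 * (card V - 1)\<close> arcs. If
  the ends of a deleted edge stayed joined, the remaining relation would be connected with two arcs
  fewer than the minimum.\<close>

lemma realization_bridge:
  assumes "finite V" "realization V d E" "(\<Sum>x\<in>V. d x) = 2 * (card V - 1)" "(a, b) \<in> E"
  shows "(a, b) \<notin> (E - {(a, b), (b, a)})\<^sup>*"
proof
  let ?F = "E - {(a, b), (b, a)}"
  assume ab: "(a, b) \<in> ?F\<^sup>*"
  have E: "E \<subseteq> V \<times> V" "sym E" "irrefl E" "\<And>x y. x \<in> V \<Longrightarrow> y \<in> V \<Longrightarrow> (x, y) \<in> E\<^sup>*"
    using assms(2) unfolding realization_def connected_rel_def by auto
  have symF: "sym ?F"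
    using E(2) by (auto simp: sym_def)
  have "E \<subseteq> ?F\<^sup>*"
    using ab rtrancl_sym_swap[OF symF ab] by auto
  then have "E\<^sup>* \<subseteq> ?F\<^sup>*"
    by (simp add: rtrancl_subset_rtrancl)
  then have "connected_rel V ?F"
    using E symF unfolding connected_rel_def irrefl_def by blast
  moreover have "finite E"
    using assms(1) E(1) finite_subset by blast
  moreover have "a \<noteq> b" "(b, a) \<in> E"
    using E assms(4) by (auto simp: irrefl_def dest: symD)
  ultimately have "2 * (card V - 1) \<le> card E - 2" "card E > 0"
    using card_connected_rel_ge[OF assms(1), of ?F] assms(4)
    by (auto simp: card_Diff_subset card_gt_0_iff)
  then show False
    using card_realization[OF assms(1,2)] assms(3) by linarith
qed

section \<open>Existence of a tree with given degrees\<close>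

text \<open>Induction by removing a leaf: the degree sum is too small for all degrees to be at least
  2 and, from three vertices on, too large for all to be at most 1. The base has two vertices
  because a single vertex would need degree 0.\<close>

lemma arboreal_realization_exists:
  assumes "card V = Suc (Suc k)" "\<And>x. x \<in> V \<Longrightarrow> 0 < d x" "(\<Sum>x\<in>V. d x) = 2 * Suc k"
  shows "\<exists>E. realization V d E"
  using assms
proof (induction k arbitrary: V d)
  case 0
  then obtain a b where ab: "V = {a, b}" "a \<noteq> b"
    by (metis One_nat_def Suc_1 card_2_iff)
  then have "0 < d a" "0 < d b" "d a + d b = 2"
    using 0 by auto
  then have d: "d a = 1" "d b = 1"
    by linarith+
  have "realization V d {(a, b), (b, a)}"
    using ab d unfolding realization_def connected_rel_def
    by (auto simp: sym_def irrefl_def Image_def)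
  then show ?case by blast
next
  case (Suc k)
  have fin: "finite V"
    using Suc.prems(1) card.infinite by fastforce
  have "\<exists>a\<in>V. d a = 1"
  proof (rule ccontr)
    assume "\<not> ?thesis"
    then have "2 \<le> d x" if "x \<in> V" for x
      using Suc.prems(2)[OF that] that by (metis One_nat_def Suc_1 Suc_leI le_neq_implies_less)
    then have "(\<Sum>x\<in>V. 2) \<le> (\<Sum>x\<in>V. d x)"
      by (rule sum_mono)
    then show False
      using Suc.prems by simp
  qed
  then obtain a where a: "a \<in> V" "d a = 1" by blast
  have "\<exists>b\<in>V. 2 \<le> d b"
  proof (rule ccontr)
    assume "\<not> ?thesis"
    then have "(\<Sum>x\<in>V. d x) \<le> (\<Sum>x\<in>V. 1)"
      by (intro sum_mono) force
    then show False
      using Suc.prems by simp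
  qed
  then obtain b where b: "b \<in> V" "2 \<le> d b" by blast
  with a have "a \<noteq> b" by auto
  define W where "W = V - {a}"
  \<comment> \<open>The leaf \<open>a\<close> will be attached to \<open>b\<close>, which therefore
    gives up one unit of degree; \<open>2 \<le> d b\<close> keeps the rest positive.\<close>
  define e where "e = d(b := d b - 1)"
  have W: "card W = Suc (Suc k)" "b \<in> W" "finite W" "a \<notin> W" "V = insert a W"
    using Suc.prems(1) a b fin \<open>a \<noteq> b\<close> unfolding W_def by auto
  have "(\<Sum>x\<in>W - {b}. e x) = (\<Sum>x\<in>W - {b}. d x)"
    unfolding e_def by (rule sum.cong) auto
  then have "(\<Sum>x\<in>W. e x) = 2 * Suc k"
    using Suc.prems(3) W a b sum.remove[OF W(3,2), of e] sum.remove[OF W(3,2), of d]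
    unfolding e_def by simp
  moreover have "0 < e x" if "x \<in> W" for x
    using that Suc.prems(2)[of x] b W unfolding e_def by auto
  ultimately obtain E where E: "realization W e E"
    using Suc.IH[of W e] W(1) by blast
  let ?F = "E \<union> {(a, b), (b, a)}"
  have EW: "E \<subseteq> W \<times> W" "sym E" "irrefl E" "\<And>x y. x \<in> W \<Longrightarrow> y \<in> W \<Longrightarrow> (x, y) \<in> E\<^sup>*"
    "\<And>x. x \<in> W \<Longrightarrow> card (E `` {x}) = e x"
    using E unfolding realization_def connected_rel_def by auto
  have reach: "(b, x) \<in> ?F\<^sup>*" if "x \<in> V" for x
  proof (cases "x = a")
    case False
    with that W EW(4)[of b x] have "(b, x) \<in> E\<^sup>*" by auto
    then show ?thesis
      by (rule rtrancl_mono[THEN subsetD, rotated]) auto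
  qed auto
  have symF: "sym ?F"
    using EW(2) by (auto simp: sym_def)
  have "(x, y) \<in> ?F\<^sup>*" if "x \<in> V" "y \<in> V" for x y
    using rtrancl_sym_swap[OF symF reach[OF that(1)]] reach[OF that(2)] by (rule rtrancl_trans)
  moreover have "card (?F `` {x}) = d x" if "x \<in> V" for x
  proof -
    consider "x = a" | "x = b" | "x \<noteq> a" "x \<noteq> b" by blast
    then show ?thesis
    proof cases
      case 1
      with EW(1) W \<open>a \<noteq> b\<close> have "?F `` {x} = {b}" by auto
      with 1 a show ?thesis by simp
    next
      case 2
      with \<open>a \<noteq> b\<close> have "?F `` {x} = insert a (E `` {b})" by auto
      moreover have "finite (E `` {b})" "a \<notin> E `` {b}"
        using EW(1) W finite_subset[of "E `` {b}" W] by auto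
      ultimately show ?thesis
        using 2 EW(5)[of b] W b unfolding e_def by simp
    next
      case 3
      then have "?F `` {x} = E `` {x}" by auto
      with 3 EW(5)[of x] W that show ?thesis
        unfolding e_def by auto
    qed
  qed
  moreover have "?F \<subseteq> V \<times> V" "irrefl ?F"
    using EW(1,3) W \<open>a \<noteq> b\<close> by (auto simp: irrefl_def)
  ultimately have "realization V d ?F"
    using symF unfolding realization_def connected_rel_def by blast
  then show ?case by blast
qed

section \<open>Degree-preserving edge exchanges\<close>

text \<open>This is the 2-switch, with the pairing that preserves connectedness when
  \<open>v\<close> and \<open>x\<close> stay joined after the deletions.\<close>

definition edge_swap :: "'a \<Rightarrow> 'a \<Rightarrow> 'a \<Rightarrow> 'a \<Rightarrow> 'a rel \<Rightarrow> 'a rel" where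
  "edge_swap u v x w E =
     E - {(u, v), (v, u), (x, w), (w, x)} \<union> {(u, x), (x, u), (v, w), (w, v)}"

lemma card_insert_remove:
  assumes "finite S" "b \<in> S" "a \<notin> S"
  shows "card (insert a (S - {b})) = card S"
  using assms by (metis Diff_iff card.remove card_insert_disjoint finite_Diff)

text \<open>The surviving walk from \<open>v\<close> to \<open>x\<close> and the new edges give
  detours around both deleted edges: from \<open>u\<close> via \<open>x\<close> to \<open>v\<close>,
  and from \<open>w\<close> via \<open>v\<close> to \<open>x\<close>. Each of the four endpoints
  trades one neighbour for another, which is new because \<open>(u, x)\<close> and
  \<open>(v, w)\<close> are not in \<open>E\<close>.\<close>

lemma realization_edge_swap:
  assumes "finite V" "realization V d E" "(u, v) \<in> E" "(x, w) \<in> E" "distinct [u, v, x, w]"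
    and "(u, x) \<notin> E" "(v, w) \<notin> E" "(v, x) \<in> (E - {(u, v), (v, u), (x, w), (w, x)})\<^sup>*"
  shows "realization V d (edge_swap u v x w E)"
proof -
  let ?F = "edge_swap u v x w E"
  have E: "E \<subseteq> V \<times> V" "sym E" "irrefl E" "\<And>x y. x \<in> V \<Longrightarrow> y \<in> V \<Longrightarrow> (x, y) \<in> E\<^sup>*"
    "\<And>x. x \<in> V \<Longrightarrow> card (E `` {x}) = d x"
    using assms(2) unfolding realization_def connected_rel_def by auto
  have sub: "?F \<subseteq> V \<times> V"
    using E(1) assms(3,4) unfolding edge_swap_def by auto
  have symF: "sym ?F"
    using E(2) unfolding edge_swap_def sym_def by blast
  have irr: "irrefl ?F"
    using E(3) assms(5) unfolding edge_swap_def irrefl_def by auto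
  have vx: "(v, x) \<in> ?F\<^sup>*"
    using assms(8) by (rule rtrancl_mono[THEN subsetD, rotated]) (auto simp: edge_swap_def)
  have "(u, x) \<in> ?F" "(w, v) \<in> ?F"
    unfolding edge_swap_def by auto
  with vx have uv: "(u, v) \<in> ?F\<^sup>*" and wx: "(w, x) \<in> ?F\<^sup>*"
    using rtrancl_sym_swap[OF symF vx] by (meson converse_rtrancl_into_rtrancl)+
  have "E \<subseteq> ?F\<^sup>*"
  proof
    fix e assume "e \<in> E"
    then have "e \<in> ?F \<or> e \<in> {(u, v), (v, u), (x, w), (w, x)}"
      unfolding edge_swap_def by auto
    then show "e \<in> ?F\<^sup>*"
      using uv wx rtrancl_sym_swap[OF symF uv] rtrancl_sym_swap[OF symF wx] by auto
  qed
  then have "E\<^sup>* \<subseteq> ?F\<^sup>*"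
    by (simp add: rtrancl_subset_rtrancl)
  moreover have "card (?F `` {z}) = d z" if "z \<in> V" for z
  proof -
    have fin: "finite (E `` {z})"
      using E(1) assms(1) finite_subset[of "E `` {z}" V] by auto
    have nin: "(x, u) \<notin> E" "(w, v) \<notin> E" and inn: "(v, u) \<in> E" "(w, x) \<in> E"
      using E(2) assms(3,4,6,7) by (auto dest: symD)
    consider "z = u" | "z = v" | "z = x" | "z = w" | "z \<notin> {u, v, x, w}" by blast
    then have "card (?F `` {z}) = card (E `` {z})"
    proof cases
      case 1
      with assms(5) have "?F `` {z} = insert x (E `` {z} - {v})"
        unfolding edge_swap_def by auto
      with 1 fin assms(3,6) show ?thesis by (simp add: card_insert_remove del: card_insert_disjoint)
    next
      case 2
      with assms(5) have "?F `` {z} = insert w (E `` {z} - {u})"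
        unfolding edge_swap_def by auto
      with 2 fin inn assms(7) show ?thesis by (simp add: card_insert_remove del: card_insert_disjoint)
    next
      case 3
      with assms(5) have "?F `` {z} = insert u (E `` {z} - {w})"
        unfolding edge_swap_def by auto
      with 3 fin nin assms(4) show ?thesis by (simp add: card_insert_remove del: card_insert_disjoint)
    next
      case 4
      with assms(5) have "?F `` {z} = insert v (E `` {z} - {x})"
        unfolding edge_swap_def by auto
      with 4 fin nin inn show ?thesis by (simp add: card_insert_remove del: card_insert_disjoint)
    next
      case 5
      then have "?F `` {z} = E `` {z}"
        unfolding edge_swap_def by auto
      then show ?thesis by simp
    qed
    then show ?thesis using E(5) that by simp
  qed
  ultimately show ?thesis
    using sub symF irr E(4) unfolding realization_def connected_rel_def by blast
qed

text \<open>The edge \<open>uv\<close> leaves the intersection with \<open>H\<close>, and neither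
  inserted edge enters it.\<close>

lemma card_edge_swap_less:
  assumes "finite E" "(u, v) \<in> E" "(u, v) \<in> H" "sym H" "(u, x) \<notin> H" "(v, w) \<notin> H"
  shows "card (edge_swap u v x w E \<inter> H) < card (E \<inter> H)"
proof (rule psubset_card_mono)
  have "(x, u) \<notin> H" "(w, v) \<notin> H"
    using assms(4-6) by (auto dest: symD)
  moreover have "(u, v) \<notin> edge_swap u v x w E \<inter> H"
    using assms(2,3,5,6) \<open>(w, v) \<notin> H\<close> unfolding edge_swap_def by auto
  ultimately show "edge_swap u v x w E \<inter> H \<subset> E \<inter> H"
    using assms(2,3,5,6) unfolding edge_swap_def by blast
qed (use assms(1) in simp)

section \<open>Charging in a minimal realization\<close>

text \<open>Otherwise the swap would lower the number of arcs in \<open>H\<close>. The work lies in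
  showing that the swap is admissible, which holds because \<open>uv\<close> and \<open>xw\<close>
  are bridges; the walk from \<open>v\<close> to \<open>x\<close> misses \<open>w\<close> and hence
  the edge \<open>xw\<close>.\<close>

lemma minimal_realization_blocked:
  assumes "finite V" "realization V d E" "(\<Sum>x\<in>V. d x) = 2 * (card V - 1)" "sym H"
    and min: "\<And>F. realization V d F \<Longrightarrow> card (E \<inter> H) \<le> card (F \<inter> H)"
    and uv: "(u, v) \<in> E" "(u, v) \<in> H"
    and xw: "(x, w) \<in> E - {(u, v), (v, u)}" "w \<noteq> v"
    and vx: "(v, x) \<in> {(y, z) \<in> E - {(u, v), (v, u)}. y \<noteq> w \<and> z \<noteq> w}\<^sup>*"
  shows "(u, x) \<in> H \<or> (v, w) \<in> H"
proof (rule ccontr)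
  assume blocked: "\<not> ?thesis"
  let ?E0 = "E - {(u, v), (v, u)}" and ?E1 = "E - {(u, v), (v, u), (x, w), (w, x)}"
  have E: "E \<subseteq> V \<times> V" "sym E" "irrefl E"
    using assms(2) unfolding realization_def connected_rel_def by auto
  have symE0: "sym ?E0" and symE1: "sym ?E1"
    using E(2) unfolding sym_def by blast+
  have vx1: "(v, x) \<in> ?E1\<^sup>*"
    using vx by (rule rtrancl_mono[THEN subsetD, rotated]) auto
  have vx0: "(v, x) \<in> ?E0\<^sup>*"
    using vx1 by (rule rtrancl_mono[THEN subsetD, rotated]) auto
  have nuv: "(v, u) \<notin> ?E0\<^sup>*"
    using realization_bridge[OF assms(1-3) uv(1)] rtrancl_sym_swap[OF symE0] by blast
  \<comment> \<open>For \<open>x = v\<close> the first alternative is just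
    \<open>(u, v) \<in> H\<close>; this is how children of \<open>v\<close> get charged to
    \<open>v\<close> as a neighbour of \<open>u\<close>.\<close>
  have "x \<noteq> v"
    using blocked uv(2) by auto
  have "x \<noteq> u"
    using vx0 nuv by auto
  have "w \<noteq> u"
    using vx0 nuv xw(1) rtrancl_into_rtrancl by metis
  have "u \<noteq> v" "x \<noteq> w"
    using E(3) uv(1) xw(1) by (auto simp: irrefl_def)
  have "(u, x) \<notin> E"
  proof
    assume "(u, x) \<in> E"
    then have "(x, u) \<in> ?E0"
      using E(2) \<open>x \<noteq> v\<close> \<open>x \<noteq> u\<close> by (auto dest: symD)
    with vx0 nuv show False
      using rtrancl_into_rtrancl by metis
  qed
  \<comment> \<open>Otherwise the walk from \<open>x\<close> back to \<open>v\<close>, followed by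
    \<open>vw\<close>, would bypass the bridge \<open>xw\<close>.\<close>
  have "(v, w) \<notin> E"
  proof
    let ?E2 = "E - {(x, w), (w, x)}"
    assume "(v, w) \<in> E"
    then have "(v, w) \<in> ?E2"
      using \<open>x \<noteq> v\<close> xw(2) by auto
    moreover have "(x, v) \<in> ?E2\<^sup>*"
      using rtrancl_sym_swap[OF symE1 vx1] by (rule rtrancl_mono[THEN subsetD, rotated]) auto
    ultimately have "(x, w) \<in> ?E2\<^sup>*"
      using rtrancl_into_rtrancl by metis
    then show False
      using realization_bridge[OF assms(1-3), of x w] xw(1) by blast
  qed
  have "realization V d (edge_swap u v x w E)"
    using realization_edge_swap[OF assms(1,2) uv(1), of x w] xw vx1 \<open>(u, x) \<notin> E\<close> \<open>(v, w) \<notin> E\<close>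
      \<open>x \<noteq> v\<close> \<open>x \<noteq> u\<close> \<open>w \<noteq> u\<close> \<open>u \<noteq> v\<close> \<open>x \<noteq> w\<close> by auto
  moreover have "finite E"
    using E(1) assms(1) finite_subset by blast
  ultimately show False
    using min card_edge_swap_less[OF _ uv assms(4), of x w] blocked by (meson leD)
qed

lemma minimal_realization_degree_bound:
  assumes "finite V" "realization V d E" "(\<Sum>x\<in>V. d x) = 2 * (card V - 1)"
    and "H \<subseteq> V \<times> V" "sym H" and r: "2 \<le> r" "\<And>x. x \<in> V \<Longrightarrow> d x \<le> r"
    and min: "\<And>F. realization V d F \<Longrightarrow> card (E \<inter> H) \<le> card (F \<inter> H)"
    and uv: "(u, v) \<in> E" "(u, v) \<in> H"
  shows "card V - 2 \<le> (r - 1) * (card (H `` {u}) + card (H `` {v}))"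
proof -
  let ?E0 = "E - {(u, v), (v, u)}"
  have E: "E \<subseteq> V \<times> V" "sym E" "irrefl E" "\<And>x y. x \<in> V \<Longrightarrow> y \<in> V \<Longrightarrow> (x, y) \<in> E\<^sup>*"
    "\<And>x. x \<in> V \<Longrightarrow> card (E `` {x}) = d x"
    using assms(2) unfolding realization_def connected_rel_def by auto
  have uV: "u \<in> V" "v \<in> V" "u \<noteq> v" "(v, u) \<in> E" "(v, u) \<in> H"
    using E(1-3) uv assms(5) by (auto simp: irrefl_def dest: symD)
  \<comment> \<open>Along a walk from \<open>u\<close> in \<open>E\<close>, each use of the edge
    \<open>uv\<close> restarts the claim at one of its ends.\<close>
  have cover: "(u, w) \<in> ?E0\<^sup>* \<or> (v, w) \<in> ?E0\<^sup>*" if "w \<in> V" for w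
  proof -
    have "(u, w) \<in> E\<^sup>*" using E(4) uV that by blast
    then show ?thesis
    proof (induction rule: rtrancl_induct)
      case (step y z)
      then show ?case
        by (cases "(y, z) \<in> ?E0") (auto intro: rtrancl_into_rtrancl)
    qed simp
  qed
  obtain p f where pf: "\<And>w. (u, w) \<in> ?E0\<^sup>* \<Longrightarrow> w \<noteq> u \<Longrightarrow>
    (p w, w) \<in> ?E0 \<and> (f (p w) :: nat) < f w \<and>
    (u, p w) \<in> {(y, z) \<in> ?E0. y \<noteq> w \<and> z \<noteq> w}\<^sup>*"
    by (rule parent_function[of u ?E0]) blast
  obtain q g where qg: "\<And>w. (v, w) \<in> ?E0\<^sup>* \<Longrightarrow> w \<noteq> v \<Longrightarrow>
    (q w, w) \<in> ?E0 \<and> (g (q w) :: nat) < g w \<and>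
    (v, q w) \<in> {(y, z) \<in> ?E0. y \<noteq> w \<and> z \<noteq> w}\<^sup>*"
    by (rule parent_function[of v ?E0]) blast
  \<comment> \<open>\<open>B\<close> is the side of \<open>v\<close>. The parent functions
    \<open>p\<close> and \<open>q\<close> are meaningful only on their own sides, so
    \<open>m\<close> chooses between them; \<open>C x\<close> omits the roots, whose parents are
    unspecified.\<close>
  define B where "B = ?E0\<^sup>* `` {v}"
  define m where "m w = (if w \<in> B then q w else p w)" for w
  define C where "C x = {w \<in> V - {u, v}. m w = x}" for x
  have up: "(m w, w) \<in> ?E0" "m w \<notin> B" "f (m w) < f w"
      "(u, m w) \<in> {(y, z) \<in> ?E0. y \<noteq> w \<and> z \<noteq> w}\<^sup>*"
    if "w \<in> V - {u, v}" "w \<notin> B" for w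
  proof -
    have "(u, w) \<in> ?E0\<^sup>*" "w \<noteq> u"
      using cover that unfolding B_def by auto
    from pf[OF this] that(2) show *: "(m w, w) \<in> ?E0" and "f (m w) < f w"
      "(u, m w) \<in> {(y, z) \<in> ?E0. y \<noteq> w \<and> z \<noteq> w}\<^sup>*"
      unfolding m_def by auto
    show "m w \<notin> B"
      using that(2) rtrancl_into_rtrancl[OF _ *, of v] unfolding B_def by blast
  qed
  have vp: "(m w, w) \<in> ?E0" "m w \<in> B" "g (m w) < g w"
      "(v, m w) \<in> {(y, z) \<in> ?E0. y \<noteq> w \<and> z \<noteq> w}\<^sup>*"
    if "w \<in> V - {u, v}" "w \<in> B" for w
  proof -
    have "(v, w) \<in> ?E0\<^sup>*" "w \<noteq> v"
      using that unfolding B_def by auto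
    from qg[OF this] that(2) show "(m w, w) \<in> ?E0" "g (m w) < g w"
      and *: "(v, m w) \<in> {(y, z) \<in> ?E0. y \<noteq> w \<and> z \<noteq> w}\<^sup>*"
      unfolding m_def by auto
    from * have "(v, m w) \<in> ?E0\<^sup>*"
      by (rule rtrancl_mono[THEN subsetD, rotated]) auto
    then show "m w \<in> B"
      unfolding B_def by auto
  qed
  \<comment> \<open>A vertex and its parent lie on the same side, where \<open>f\<close> or
    \<open>g\<close> decreases towards the root; so two vertices other than the roots cannot be each
    other's parent.\<close>
  have mE: "(m w, w) \<in> ?E0" and mm: "m (m w) \<noteq> w \<or> m w \<in> {u, v}" if "w \<in> V - {u, v}" for w
  proof -
    show *: "(m w, w) \<in> ?E0" using up(1) vp(1) that by blast
    have "m w \<in> V" using * E(1) by auto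
    then show "m (m w) \<noteq> w \<or> m w \<in> {u, v}"
      using up[of w] vp[of w] up[of "m w"] vp[of "m w"] that by (cases "w \<in> B") force+
  qed
  have Cle: "card (C x) \<le> r - 1" if "x \<in> V" for x
  proof -
    \<comment> \<open>One of the at most \<open>r\<close> neighbours is not a child: at a root the
      other end of \<open>uv\<close>, elsewhere the parent.\<close>
    have "\<exists>y \<in> E `` {x}. y \<notin> C x"
    proof (cases "x \<in> {u, v}")
      case True
      then show ?thesis using uv uV unfolding C_def by auto
    next
      case False
      with that have "(m x, x) \<in> E" using mE by auto
      then have "(x, m x) \<in> E" using E(2) by (auto dest: symD)
      moreover have "m x \<notin> C x"
        using mm[of x] False that mm[of "m x"] unfolding C_def by force
      ultimately show ?thesis by blast
    qed
    then obtain y where y: "y \<in> E `` {x}" "y \<notin> C x" by blast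
    have "C x \<subseteq> E `` {x} - {y}"
      using mE E(2) y(2) unfolding C_def by (auto dest: symD)
    moreover have "finite (E `` {x})"
      using E(1) assms(1) finite_subset[of "E `` {x}" V] by auto
    ultimately have "card (C x) \<le> card (E `` {x}) - 1"
      using y(1) by (metis card_Diff_singleton card_mono finite_Diff)
    then show ?thesis
      using E(5)[OF that] r(2)[OF that] by linarith
  qed
  \<comment> \<open>\<open>D\<close> collects the vertices charged to \<open>x\<close>: its children
    if \<open>x\<close> lies on the side opposite to the end of \<open>uv\<close> whose neighbour it
    is, and only \<open>x\<close> itself otherwise. The singleton fits the bound
    \<open>r - 1\<close> because \<open>2 \<le> r\<close>.\<close>
  define D where "D P x = (if P then C x else {x})" for P x
  have Dle: "card (D P x) \<le> r - 1" if "x \<in> V" for P x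
    using Cle[OF that] r(1) unfolding D_def by auto
  have finH: "finite (H `` {x})" for x
    using assms(1,4) finite_subset[of "H `` {x}" V] by auto
  let ?U = "\<Union>x\<in>H `` {u}. D (x \<in> B) x" and ?W = "\<Union>x\<in>H `` {v}. D (x \<notin> B) x"
  have "V - {u, v} \<subseteq> ?U \<union> ?W"
  proof
    fix w assume w: "w \<in> V - {u, v}"
    show "w \<in> ?U \<union> ?W"
    proof (cases "w \<in> B")
      case True
      have "(u, m w) \<in> H \<or> (v, w) \<in> H"
        using minimal_realization_blocked[OF assms(1-3,5) min uv vp(1)[OF w True] _ vp(4)[OF w True]]
          w by blast
      then show ?thesis
        using True w vp(2)[OF w True] unfolding D_def C_def by auto
    next
      case False
      \<comment> \<open>The blocking lemma is applied with \<open>u\<close> and \<open>v\<close>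
        interchanged, which reverses the listing of the deleted arcs.\<close>
      have *: "E - {(u, v), (v, u)} = E - {(v, u), (u, v)}" by blast
      have "(v, m w) \<in> H \<or> (u, w) \<in> H"
        using minimal_realization_blocked[OF assms(1-3,5) min uV(4,5), of "m w" w]
          up(1,4)[OF w False] w unfolding * by blast
      then show ?thesis
        using False w up(2)[OF w False] unfolding D_def C_def by auto
    qed
  qed
  moreover have "finite (D P x)" for P x
    using assms(1) unfolding D_def C_def by simp
  ultimately have "card (V - {u, v}) \<le> card ?U + card ?W"
    using finH by (meson card_Un_le card_mono finite_UN finite_UnI order_trans)
  also have "card ?U \<le> (\<Sum>x\<in>H `` {u}. r - 1)"
    by (rule order_trans[OF card_UN_le[OF finH] sum_mono]) (use Dle assms(4) in auto)
  also have "card ?W \<le> (\<Sum>x\<in>H `` {v}. r - 1)"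
    by (rule order_trans[OF card_UN_le[OF finH] sum_mono]) (use Dle assms(4) in auto)
  finally show ?thesis
    using uV assms(1) by (simp add: algebra_simps card_Diff_subset)
qed

section \<open>Cycles, and the passage to library trees\<close>

lemma (in pair_wf_digraph) awalk_avoiding:
  assumes "awalk c q a" "b \<notin> set (pawalk_verts c q)"
  shows "(c, a) \<in> {(y, z) \<in> parcs G. y \<noteq> b \<and> z \<noteq> b}\<^sup>*"
  using assms
proof (induction q arbitrary: c)
  case Nil
  then show ?case by (simp add: awalk_Nil_iff)
next
  case (Cons e q)
  then have e: "e \<in> parcs G" "c = fst e" "awalk (snd e) q a" "fst e \<noteq> b"
      "b \<notin> set (pawalk_verts (snd e) q)"
    by (auto simp: awalk_Cons_iff)
  moreover have "snd e \<in> set (pawalk_verts (snd e) q)"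
    using e(3) by (cases q) (auto simp: awalk_Cons_iff)
  ultimately show ?case
    using Cons.IH[of "snd e"]
    by (cases e) (auto intro!: converse_rtrancl_into_rtrancl[of c "snd e"])
qed

text \<open>For a cycle \<open>u, b, c, ..., u\<close> the part from \<open>c\<close> to
  \<open>u\<close> avoids \<open>b\<close>, so going on from \<open>b\<close> bypasses the edge
  \<open>ub\<close>. Length at least 3 ensures \<open>c \<noteq> u\<close>, so that the step from
  \<open>b\<close> to \<open>c\<close> is not \<open>ub\<close> reversed.\<close>

lemma (in pair_wf_digraph) cycle_rtrancl_without_edge:
  assumes "cycle p" "3 \<le> length p"
  obtains a b where "(a, b) \<in> parcs G" "(b, a) \<in> (parcs G - {(a, b), (b, a)})\<^sup>*"
proof -
  obtain u where u: "awalk u p u" "distinct (tl (pawalk_verts u p))"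
    using assms(1) unfolding cycle_def by auto
  obtain e1 e2 e3 q where p: "p = e1 # e2 # e3 # q"
    using assms(2) by (metis Suc_le_length_iff numeral_3_eq_3)
  define b c where "b = fst e2" and "c = fst e3"
  have e: "e1 = (u, b)" "e2 = (b, c)" "(u, b) \<in> parcs G" "(b, c) \<in> parcs G"
      "awalk c (e3 # q) u" "awalk (snd e3) q u"
    using u(1) unfolding p b_def c_def
    by (cases e1; cases e2; cases e3; auto simp: awalk_Cons_iff)+
  have dist: "b \<notin> set (pawalk_verts c (e3 # q))" "c \<notin> set (pawalk_verts (snd e3) q)"
    using u(2) unfolding p b_def c_def by auto
  have "u \<in> set (pawalk_verts (snd e3) q)"
    using e(6) by (induction q arbitrary: e3) (auto simp: awalk_Cons_iff awalk_Nil_iff)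
  with dist(2) have "c \<noteq> u" by auto
  have "(c, u) \<in> (parcs G - {(u, b), (b, u)})\<^sup>*"
    using awalk_avoiding[OF e(5) dist(1)] by (rule rtrancl_mono[THEN subsetD, rotated]) auto
  moreover have "(b, c) \<in> parcs G - {(u, b), (b, u)}"
    using e(4) \<open>c \<noteq> u\<close> by auto
  ultimately show ?thesis
    using that[OF e(3)] converse_rtrancl_into_rtrancl by metis
qed

text \<open>A cycle of length at least 3 would contain an edge that is not a bridge, against
  \<open>realization_bridge\<close>.\<close>

lemma realization_undirected_tree:
  assumes "finite V" "V \<noteq> {}" "realization V d E" "(\<Sum>x\<in>V. d x) = 2 * (card V - 1)"
  shows "undirected_tree \<lparr>pverts = V, parcs = E\<rparr>"
proof -
  let ?T = "\<lparr>pverts = V, parcs = E\<rparr>"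
  have E: "E \<subseteq> V \<times> V" "sym E" "irrefl E" "\<And>x y. x \<in> V \<Longrightarrow> y \<in> V \<Longrightarrow> (x, y) \<in> E\<^sup>*"
    using assms(3) unfolding realization_def connected_rel_def by auto
  have finE: "finite E"
    using assms(1) E(1) finite_subset by blast
  interpret T: pair_graph ?T
    using E(1-3) assms(1) finE
    by unfold_locales (auto simp: symmetric_def irrefl_def)
  have reach: "x \<rightarrow>\<^sup>*\<^bsub>?T\<^esub> y" if "x \<in> V" "y \<in> V" for x y
    using E(4)[OF that]
  proof (induction rule: rtrancl_induct)
    case base
    then show ?case using that by simp
  next
    case (step y z)
    then show ?case using T.reachable_adj_trans by auto
  qed
  have "connected (with_proj ?T)"
    unfolding connected_def
  proof (rule strongly_connectedI)
    show "verts (with_proj (mk_symmetric (with_proj ?T))) \<noteq> {}"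
      using assms(2) by simp
  next
    fix x y
    assume "x \<in> verts (with_proj (mk_symmetric (with_proj ?T)))"
      "y \<in> verts (with_proj (mk_symmetric (with_proj ?T)))"
    then show "x \<rightarrow>\<^sup>*\<^bsub>with_proj (mk_symmetric (with_proj ?T))\<^esub> y"
      using reach by (intro T.reachable_mk_symmetricI) auto
  qed
  moreover have False if p: "T.cycle p" "3 \<le> length p" for p
  proof -
    obtain a b where "(a, b) \<in> E" "(b, a) \<in> (E - {(a, b), (b, a)})\<^sup>*"
      using T.cycle_rtrancl_without_edge[OF p] by (metis pair_pre_digraph.select_convs(2))
    moreover have "E - {(a, b), (b, a)} = E - {(b, a), (a, b)}" for a b
      by blast
    ultimately show False
      using realization_bridge[OF assms(1,3,4), of b a] E(2) by (auto dest: symD)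
  qed
  ultimately show ?thesis
    using T.pair_graph_axioms unfolding undirected_tree_def undirected_forest_def by blast
qed

lemma degree_eq_card_Image: "degree G x = card (parcs G `` {x})"
proof -
  have "out_arcs (with_proj G) x = Pair x ` (parcs G `` {x})"
    unfolding out_arcs_def by auto
  then show ?thesis
    unfolding out_degree_def by (simp add: card_image inj_on_def)
qed

section \<open>The degree condition, read in the complement\<close>

theorem theorem3:
  fixes r n :: nat and G :: "'a pair_pre_digraph" and v :: "nat \<Rightarrow> 'a"
  assumes "r \<ge> 2"
    and "pair_graph G"
    and "bij_betw v {1..n} (pverts G)"
    and "n \<ge> r + 1"
    and "\<And>x y. \<lbrakk>x \<in> pverts G; y \<in> pverts G; x \<noteq> y; (x, y) \<notin> parcs G\<rbrakk> \<Longrightarrow>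
           real (degree G x) + real (degree G y)
             \<ge> ((2 * real r - 3) * real n - (2 * real r - 5)) / (real r - 1)"
  shows "\<forall>d. arboreal n d \<and> (\<forall>i\<in>{1..n}. 1 \<le> d i \<and> d i \<le> r) \<longrightarrow>
           (\<exists>T. undirected_spanning_tree T G \<and> has_degree_sequence T v n d)"
proof (intro allI impI)
  fix d assume d: "arboreal n d \<and> (\<forall>i\<in>{1..n}. 1 \<le> d i \<and> d i \<le> r)"
  interpret G: pair_graph G by fact
  define V where "V = pverts G"
  define D where "D x = d (the_inv_into {1..n} v x)" for x
  have inj: "inj_on v {1..n}" and V: "V = v ` {1..n}"
    using assms(3) unfolding V_def bij_betw_def by auto
  have D: "D (v i) = d i" if "i \<in> {1..n}" for i
    unfolding D_def using the_inv_into_f_f[OF inj that] by simp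
  have fin: "finite V" and card: "card V = n"
    unfolding V using card_image[OF inj] by auto
  have "int (\<Sum>x\<in>V. D x) = 2 * (int n - 1)"
    using d D unfolding V sum.reindex[OF inj] arboreal_def by simp
  \<comment> \<open>The subtraction on naturals agrees with the integer one because \<open>n\<close>
    is positive.\<close>
  also have "\<dots> = int (2 * (card V - 1))"
    using card assms(4) by simp
  finally have sumD: "(\<Sum>x\<in>V. D x) = 2 * (card V - 1)"
    using of_nat_eq_iff by blast
  have Dbounds: "0 < D x" "D x \<le> r" if "x \<in> V" for x
    using that d D unfolding V by force+
  define H where "H = {(x, y). x \<in> V \<and> y \<in> V \<and> x \<noteq> y \<and> (x, y) \<notin> parcs G}"
  have symG: "sym (parcs G)"
    using G.pair_sym_arcs unfolding symmetric_def by simp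
  have H: "H \<subseteq> V \<times> V" "sym H"
    using symG unfolding H_def sym_def by auto
  have degH: "real (card (H `` {x})) = real n - 1 - real (degree G x)" if "x \<in> V" for x
  proof -
    have sub: "parcs G `` {x} \<subseteq> V - {x}"
      using G.in_arcsD2 G.no_loops' unfolding V_def by auto
    have "H `` {x} = V - {x} - parcs G `` {x}"
      using that unfolding H_def by auto
    then have "card (H `` {x}) = card (V - {x}) - card (parcs G `` {x})"
      using sub fin by (simp add: card_Diff_subset finite_subset)
    moreover have "card (parcs G `` {x}) \<le> card (V - {x})"
      using sub fin by (simp add: card_mono)
    ultimately show ?thesis
      using that fin card assms(4) by (simp add: degree_eq_card_Image)
  qed
  \<comment> \<open>\<open>r \<ge> 2\<close> and \<open>n \<ge> r + 1\<close> give at least three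
    vertices.\<close>
  obtain k where "n = Suc (Suc k)"
    using assms(1,4) by (metis One_nat_def Suc_1 add_leD1 le_Suc_ex le_trans plus_1_eq_Suc add_Suc)
  then have "\<exists>E. realization V D E"
    using arboreal_realization_exists[of V k D] card Dbounds sumD by simp
  then obtain E where E: "realization V D E"
    and min: "\<And>F. realization V D F \<Longrightarrow> card (E \<inter> H) \<le> card (F \<inter> H)"
    using ex_has_least_nat[of "realization V D" _ "\<lambda>E. card (E \<inter> H)"] by blast
  have EV: "E \<subseteq> V \<times> V" "irrefl E"
    using E unfolding realization_def connected_rel_def by auto
  have "E \<inter> H = {}"
  proof (rule ccontr)
    assume "E \<inter> H \<noteq> {}"
    then obtain x y where xy: "(x, y) \<in> E" "(x, y) \<in> H" by auto
    then have xy': "x \<in> V" "y \<in> V" "x \<noteq> y" "(x, y) \<notin> parcs G"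
      unfolding H_def by auto
    have "card V - 2 \<le> (r - 1) * (card (H `` {x}) + card (H `` {y}))"
      by (rule minimal_realization_degree_bound[OF fin E sumD H assms(1) Dbounds(2) min xy])
    then have "real (n - 2) \<le> real ((r - 1) * (card (H `` {x}) + card (H `` {y})))"
      unfolding card by (rule of_nat_mono)
    also have "\<dots> = (real r - 1) * (2 * real n - 2 - (real (degree G x) + real (degree G y)))"
      using degH xy' assms(1) by (simp add: of_nat_diff)
    also have "\<dots> \<le> (real r - 1) *
        (2 * real n - 2 - ((2 * real r - 3) * real n - (2 * real r - 5)) / (real r - 1))"
      using assms(5)[of x y] xy' assms(1) unfolding V_def by (intro mult_left_mono) auto
    \<comment> \<open>The constants of the degree condition yield \<open>(r - 1) * (2 * n - 2) - ((2
      * r - 3) * n - (2 * r - 5)) = n - 3\<close>, one less than the \<open>n - 2\<close> vertices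
      that must be charged.\<close>
    also have "\<dots> = real n - 3"
      using assms(1) by (simp add: field_simps)
    finally show False
      using assms(1,4) by (simp add: of_nat_diff)
  qed
  then have EG: "E \<subseteq> parcs G"
    using EV unfolding H_def irrefl_def by blast
  let ?T = "\<lparr>pverts = V, parcs = E\<rparr>"
  have "V \<noteq> {}"
    using card assms(4) by auto
  then have tree: "undirected_tree ?T"
    by (rule realization_undirected_tree[OF fin _ E sumD])
  have "pair_wf_digraph ?T"
    using EV(1) by unfold_locales auto
  then have "wf_digraph (with_proj ?T)"
    by (simp add: wf_digraph_wp_iff)
  then have "spanning (with_proj ?T) (with_proj G)"
    using EG G.wf_digraph_axioms unfolding spanning_def subgraph_def compatible_def V_def
    by (simp add: wf_digraph_wp_iff)
  moreover have "has_degree_sequence ?T v n d"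
    using E D V unfolding has_degree_sequence_def realization_def degree_eq_card_Image by auto
  ultimately show "\<exists>T. undirected_spanning_tree T G \<and> has_degree_sequence T v n d"
    using tree unfolding undirected_spanning_tree_def by blast
qed

end
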